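(* Let $\mathbf{G}$ be an abelian group, let $A,B\subseteq\mathbf{G}$ be finite sets, let $k,l$ be positive integers, and let $q:\mathbf{G}^k\to\mathbb{C}$ be an arbitrary function. Then $$|A|^{2l}\left|\sum_{x\in\mathbf{G}^k}q(x)\,|A^B_x|\right|^2\le \mathsf{E}_{k+l+1}(B,A)\cdot\sum_{x\in\mathbf{G}^k}\left|A^l\pm\Delta_l(A^B_x)\right|\,|q(x)|^2 ,$$ where the inequality holds for each of the two choices of the sign $\pm$.
   Context: For $x=(x_1,\dots,x_k)\in\mathbf{G}^k$ put $A^B_x=B\cap(A-x_1)\cap\dots\cap(A-x_k)$. For a set $S\subseteq\mathbf{G}$, $\Delta_l(S)=\{(s,s,\dots,s)\in\mathbf{G}^l: s\in S\}$. $A^l\subseteq\mathbf{G}^l$ is the Cartesian power, and $A^l\pm\Delta_l(S)=\{a\pm d: a\in A^l,\ d\in\Delta_l(S)\}$ (empty if $S$ is empty). For a finite set $S$, $(S\circ S)(x)=|\{(s,s')\in S\times S: s'-s=x\}|$. The higher energy is $\mathsf{E}_m(B,A)=\sum_{x\in\mathbf{G}}(B\circ B)(x)\,(A\circ A)(x)^{m-1}$. *)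

theory Defs
  imports "HOL-Analysis.Infinite_Sum" "HOL-Library.FuncSet"
begin

text \<open>
  The abelian group is the additive group of a type of class \<^class>\<open>ab_group_add\<close>, possibly
  infinite. An \<open>n\<close>-tuple is a function on \<open>{..<n}\<close>, extended by \<^const>\<open>undefined\<close>, so
  indices run from \<open>0\<close> to \<open>n - 1\<close>.
\<close>

definition cart_power :: "nat \<Rightarrow> 'a set \<Rightarrow> (nat \<Rightarrow> 'a) set" where
  "cart_power n S = (\<Pi>\<^sub>E i\<in>{..<n}. S)"

definition tuple_plus :: "nat \<Rightarrow> (nat \<Rightarrow> 'a::ab_group_add) \<Rightarrow> (nat \<Rightarrow> 'a) \<Rightarrow> nat \<Rightarrow> 'a" where
  "tuple_plus n u v = (\<lambda>i\<in>{..<n}. u i + v i)"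

definition tuple_minus :: "nat \<Rightarrow> (nat \<Rightarrow> 'a::ab_group_add) \<Rightarrow> (nat \<Rightarrow> 'a) \<Rightarrow> nat \<Rightarrow> 'a" where
  "tuple_minus n u v = (\<lambda>i\<in>{..<n}. u i - v i)"

definition diagonal :: "nat \<Rightarrow> 'a set \<Rightarrow> (nat \<Rightarrow> 'a) set" where
  "diagonal n S = {\<lambda>i\<in>{..<n}. s | s. s \<in> S}"

definition sumset :: "nat \<Rightarrow> (nat \<Rightarrow> 'a::ab_group_add) set \<Rightarrow> (nat \<Rightarrow> 'a) set \<Rightarrow> (nat \<Rightarrow> 'a) set" where
  "sumset n X Y = {tuple_plus n a d | a d. a \<in> X \<and> d \<in> Y}"

definition diffset :: "nat \<Rightarrow> (nat \<Rightarrow> 'a::ab_group_add) set \<Rightarrow> (nat \<Rightarrow> 'a) set \<Rightarrow> (nat \<Rightarrow> 'a) set" where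
  "diffset n X Y = {tuple_minus n a d | a d. a \<in> X \<and> d \<in> Y}"

definition translate_inter :: "nat \<Rightarrow> 'a::ab_group_add set \<Rightarrow> 'a set \<Rightarrow> (nat \<Rightarrow> 'a) \<Rightarrow> 'a set" where
  "translate_inter k A B x = B \<inter> (\<Inter>i\<in>{..<k}. (\<lambda>a. a - x i) ` A)"

definition corr :: "'a::ab_group_add set \<Rightarrow> 'a \<Rightarrow> nat" where
  "corr S x = card {(s, s'). s \<in> S \<and> s' \<in> S \<and> s' - s = x}"

text \<open>
  Sums over the group and its powers are written with \<^const>\<open>infsum\<close>, because \<^const>\<open>sum\<close>
  is \<open>0\<close> on infinite index sets. For finite \<open>A\<close> and \<open>B\<close> all summands
  involved have finite support, so no convergence question arises.
\<close>

definition higher_energy :: "nat \<Rightarrow> 'a::ab_group_add set \<Rightarrow> 'a set \<Rightarrow> real" where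
  "higher_energy m B A = (\<Sum>\<^sub>\<infinity>x\<in>UNIV. real (corr B x) * real (corr A x) ^ (m - 1))"

end

theory Submission imports Defs "HOL-Analysis.Convex" begin

text \<open>
  For \<open>b \<in> B\<close> put \<open>W b = (A - b)\<^sup>k \<times> (A \<plusminus> b)\<^sup>l\<close>. The fibre over \<open>x\<close> of the union of the
  \<open>W b\<close> is \<open>A\<^sup>l \<plusminus> \<Delta>\<^sub>l(A\<^sup>B\<^sub>x)\<close>, and summing \<open>q\<close> over this union with
  multiplicity gives \<open>|A|\<^sup>l\<close> times the sum on the left. The Cauchy-Schwarz inequality then leaves
  the sum of the squared multiplicities, which counts the intersections \<open>W b \<inter> W b'\<close> and equals
  the energy.
\<close>

text \<open>Double counting of the incidences \<open>p \<in> W s\<close>, each weighted by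
  \<open>g p\<close>.\<close>

lemma sum_multiplicity:
  fixes g :: "'p \<Rightarrow> 'c::comm_semiring_1"
  assumes "finite B" and "\<And>s. s \<in> B \<Longrightarrow> finite (W s)"
  shows "(\<Sum>p\<in>(\<Union>s\<in>B. W s). g p * of_nat (card {s \<in> B. p \<in> W s})) = (\<Sum>s\<in>B. sum g (W s))"
proof -
  let ?U = "\<Union>s\<in>B. W s"
  have U: "finite ?U"
    using assms by blast
  have "(\<Sum>p\<in>?U. g p * of_nat (card {s \<in> B. p \<in> W s}))
      = (\<Sum>p\<in>?U. \<Sum>s | s \<in> B \<and> p \<in> W s. g p)"
    by (simp add: mult.commute)
  also have "\<dots> = (\<Sum>s\<in>B. \<Sum>p | p \<in> ?U \<and> p \<in> W s. g p)"
    by (rule sum.swap_restrict[OF U assms(1)])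
  also have "\<dots> = (\<Sum>s\<in>B. sum g (W s))"
    by (intro sum.cong) auto
  finally show ?thesis .
qed

text \<open>One factor of the square serves as the weight \<open>g\<close> in
  \<open>sum_multiplicity\<close>. The other is then the multiplicity being summed, so every
  \<open>p\<close> is counted once for each pair \<open>(s, s')\<close> with \<open>p\<close> in
  both sets.\<close>

lemma sum_multiplicity_squared:
  assumes "finite B" and "\<And>s. s \<in> B \<Longrightarrow> finite (W s)"
  shows "(\<Sum>p\<in>(\<Union>s\<in>B. W s). (real (card {s \<in> B. p \<in> W s}))\<^sup>2)
       = (\<Sum>s\<in>B. \<Sum>s'\<in>B. real (card (W s \<inter> W s')))"
proof -
  have "(\<Sum>p\<in>W s. real (card {s' \<in> B. p \<in> W s'})) = (\<Sum>s'\<in>B. real (card (W s \<inter> W s')))"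
    if s: "s \<in> B" for s
  proof -
    have "(\<Sum>p\<in>W s. real (card {s' \<in> B. p \<in> W s'})) = (\<Sum>p\<in>W s. \<Sum>s' | s' \<in> B \<and> p \<in> W s'. 1)"
      by simp
    also have "\<dots> = (\<Sum>s'\<in>B. \<Sum>p | p \<in> W s \<and> p \<in> W s'. 1)"
      by (rule sum.swap_restrict[OF assms(2)[OF s] assms(1)])
    finally show ?thesis
      by (simp add: Int_def)
  qed
  then show ?thesis
    by (simp add: power2_eq_square sum_multiplicity[OF assms])
qed

lemma norm_sum_mult_squared_le:
  fixes f :: "'p \<Rightarrow> complex" and r :: "'p \<Rightarrow> nat"
  shows "(cmod (\<Sum>p\<in>I. f p * of_nat (r p)))\<^sup>2
       \<le> (\<Sum>p\<in>I. (real (r p))\<^sup>2) * (\<Sum>p\<in>I. (cmod (f p))\<^sup>2)"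
proof -
  have "cmod (\<Sum>p\<in>I. f p * of_nat (r p)) \<le> (\<Sum>p\<in>I. real (r p) * cmod (f p))"
    by (rule order.trans[OF norm_sum]) (simp add: norm_mult mult.commute)
  then have "(cmod (\<Sum>p\<in>I. f p * of_nat (r p)))\<^sup>2 \<le> (\<Sum>p\<in>I. real (r p) * cmod (f p))\<^sup>2"
    by (intro power_mono) auto
  also have "\<dots> \<le> (\<Sum>p\<in>I. (real (r p))\<^sup>2) * (\<Sum>p\<in>I. (cmod (f p))\<^sup>2)"
    by (rule Cauchy_Schwarz_ineq_sum)
  finally show ?thesis .
qed

text \<open>The combinatorial core, free of group structure: \<open>P s\<close> and
  \<open>Q s\<close> are the two factors of \<open>W s\<close>. That all \<open>Q s\<close> have the
  same size \<open>N\<close> is what lets this factor be pulled out of the sum over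
  \<open>s\<close>.\<close>

lemma incidence_inequality:
  fixes q :: "'x \<Rightarrow> complex" and P :: "'b \<Rightarrow> 'x set" and Q :: "'b \<Rightarrow> 'z set"
  assumes B: "finite B"
    and P: "\<And>s. s \<in> B \<Longrightarrow> finite (P s)"
    and Q: "\<And>s. s \<in> B \<Longrightarrow> finite (Q s)"
    and N: "\<And>s. s \<in> B \<Longrightarrow> card (Q s) = N"
  shows "(real N)\<^sup>2 * (cmod (\<Sum>x\<in>(\<Union>s\<in>B. P s). q x * of_nat (card {s \<in> B. x \<in> P s})))\<^sup>2
       \<le> (\<Sum>s\<in>B. \<Sum>s'\<in>B. real (card (P s \<inter> P s') * card (Q s \<inter> Q s'))) *
         (\<Sum>x\<in>(\<Union>s\<in>B. P s). real (card (\<Union>s\<in>{s \<in> B. x \<in> P s}. Q s)) * (cmod (q x))\<^sup>2)"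
proof -
  let ?W = "\<lambda>s. P s \<times> Q s"
  let ?X = "\<Union>s\<in>B. P s" and ?I = "\<Union>s\<in>B. ?W s"
  let ?r = "\<lambda>p. card {s \<in> B. p \<in> ?W s}"
  have W: "\<And>s. s \<in> B \<Longrightarrow> finite (?W s)"
    using P Q by blast
  \<comment> \<open>The weight depends only on the first component, so each
    \<open>x \<in> P s\<close> is counted once for every element of \<open>Q s\<close>, that is
    \<open>N\<close> times.\<close>
  have "(\<Sum>p\<in>?I. q (fst p) * of_nat (?r p)) = (\<Sum>s\<in>B. \<Sum>p\<in>?W s. q (fst p))"
    by (rule sum_multiplicity[OF B W])
  also have "\<dots> = (\<Sum>s\<in>B. \<Sum>x\<in>P s. of_nat N * q x)"
    by (intro sum.cong refl) (simp add: sum.cartesian_product' N)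
  also have "\<dots> = of_nat N * (\<Sum>s\<in>B. sum q (P s))"
    by (simp add: sum_distrib_left)
  also have "\<dots> = of_nat N * (\<Sum>x\<in>?X. q x * of_nat (card {s \<in> B. x \<in> P s}))"
    by (simp add: sum_multiplicity[OF B P])
  finally have lhs: "(\<Sum>p\<in>?I. q (fst p) * of_nat (?r p)) = \<dots>" .
  \<comment> \<open>The union is fibred over \<open>x\<close> and \<open>q\<close> is constant on
    each fibre. Hence the second Cauchy-Schwarz factor, which carries no multiplicities, weights
    \<open>x\<close> by the size of its fibre.\<close>
  have "?I = Sigma ?X (\<lambda>x. \<Union>s\<in>{s \<in> B. x \<in> P s}. Q s)"
    by auto
  then have "(\<Sum>p\<in>?I. (cmod (q (fst p)))\<^sup>2)
      = (\<Sum>x\<in>?X. \<Sum>z\<in>(\<Union>s\<in>{s \<in> B. x \<in> P s}. Q s). (cmod (q x))\<^sup>2)"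
    using B P Q by (subst sum.Sigma) (auto simp: case_prod_beta)
  then have rhs: "(\<Sum>p\<in>?I. (cmod (q (fst p)))\<^sup>2)
      = (\<Sum>x\<in>?X. real (card (\<Union>s\<in>{s \<in> B. x \<in> P s}. Q s)) * (cmod (q x))\<^sup>2)"
    by simp
  have "(\<Sum>p\<in>?I. (real (?r p))\<^sup>2) = (\<Sum>s\<in>B. \<Sum>s'\<in>B. real (card (?W s \<inter> ?W s')))"
    by (rule sum_multiplicity_squared[OF B W])
  also have "\<dots> = (\<Sum>s\<in>B. \<Sum>s'\<in>B. real (card (P s \<inter> P s') * card (Q s \<inter> Q s')))"
    by (simp add: Times_Int_Times card_cartesian_product)
  finally have mid: "(\<Sum>p\<in>?I. (real (?r p))\<^sup>2) = \<dots>" .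
  show ?thesis
    using norm_sum_mult_squared_le[of "\<lambda>p. q (fst p)" ?r ?I]
    unfolding lhs rhs mid by (simp add: norm_mult power_mult_distrib)
qed

text \<open>The power of \<open>A - s\<close>; at \<open>- s\<close> it is the power of
  \<open>A + s\<close>, so both signs are covered.\<close>

definition translate_power :: "nat \<Rightarrow> 'a::ab_group_add set \<Rightarrow> 'a \<Rightarrow> (nat \<Rightarrow> 'a) set" where
  "translate_power n A s = cart_power n ((\<lambda>a. a - s) ` A)"

lemma finite_translate_power: "finite A \<Longrightarrow> finite (translate_power n A s)"
  by (auto simp: translate_power_def cart_power_def intro!: finite_PiE)

lemma card_translate_power: "card (translate_power n A s) = card A ^ n"
  by (simp add: translate_power_def cart_power_def card_PiE card_image inj_on_def)

text \<open>The intersection of the powers is the power of the intersection. A point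
  \<open>t\<close> common to \<open>A - s\<close> and \<open>A - s'\<close> corresponds to the pair
  \<open>(t + s, t + s')\<close> of elements of \<open>A\<close>, whose difference is
  \<open>s' - s\<close>.\<close>

lemma card_translate_power_Int:
  "card (translate_power n A s \<inter> translate_power n A s') = corr A (s' - s) ^ n"
proof -
  let ?T = "(\<lambda>a. a - s) ` A \<inter> (\<lambda>a. a - s') ` A"
  have "bij_betw (\<lambda>(a, a'). a - s) {(a, a'). a \<in> A \<and> a' \<in> A \<and> a' - a = s' - s} ?T"
  proof (rule bij_betw_byWitness[where f' = "\<lambda>t. (t + s, t + s')"])
    show "\<forall>p\<in>{(a, a'). a \<in> A \<and> a' \<in> A \<and> a' - a = s' - s}.
        ((case p of (a, a') \<Rightarrow> a - s) + s, (case p of (a, a') \<Rightarrow> a - s) + s') = p"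
      by (auto simp: algebra_simps)
    show "(\<lambda>(a, a'). a - s) ` {(a, a'). a \<in> A \<and> a' \<in> A \<and> a' - a = s' - s} \<subseteq> ?T"
    proof clarify
      fix a a' assume "a \<in> A" "a' \<in> A" "a' - a = s' - s"
      moreover from this have "a - s = a' - s'"
        by (simp add: algebra_simps)
      ultimately show "a - s \<in> ?T"
        by (metis IntI imageI)
    qed
  qed (auto simp: algebra_simps)
  then have "card ?T = corr A (s' - s)"
    unfolding corr_def by (simp add: bij_betw_same_card)
  then show ?thesis
    by (simp add: translate_power_def cart_power_def PiE_Int card_PiE)
qed

text \<open>Swapping the components of a pair negates its difference. This symmetry makes the same
  energy serve for both signs.\<close>

lemma corr_minus: "corr A (- d) = corr A d"
proof -
  have "bij_betw prod.swap {(s, s'). s \<in> A \<and> s' \<in> A \<and> s' - s = - d}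
      {(s, s'). s \<in> A \<and> s' \<in> A \<and> s' - s = d}"
    by (rule bij_betw_byWitness[where f' = prod.swap]) (auto simp: algebra_simps)
  then show ?thesis
    unfolding corr_def by (rule bij_betw_same_card)
qed

lemma corr_eq_sum:
  assumes "finite S"
  shows "corr S d = (\<Sum>(s, s')\<in>S \<times> S. of_bool (s' - s = d))"
proof -
  have "{(s, s'). s \<in> S \<and> s' \<in> S \<and> s' - s = d} = {p \<in> S \<times> S. snd p - fst p = d}"
    by auto
  then show ?thesis
    using assms by (simp add: corr_def case_prod_beta Int_def)
qed

text \<open>Groups the pairs in \<open>B \<times> B\<close> by their difference \<open>d\<close>:
  exactly \<open>corr B d\<close> of them share it. The index \<open>m + 1\<close> cancels the shift
  in the exponent of \<open>higher_energy\<close>.\<close>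

lemma higher_energy_eq_sum:
  assumes "finite B"
  shows "higher_energy (m + 1) B A = (\<Sum>s\<in>B. \<Sum>s'\<in>B. real (corr A (s' - s)) ^ m)"
proof -
  let ?D = "(\<lambda>(s, s'). s' - s) ` (B \<times> B)"
  have D: "finite ?D"
    using assms by simp
  \<comment> \<open>\<open>corr B\<close> is supported on the finite difference set of
    \<open>B\<close>, so the sum over the group is a finite one.\<close>
  have zero: "corr B d = 0" if "d \<notin> ?D" for d
    using that assms by (force simp: corr_eq_sum)
  have "higher_energy (m + 1) B A = (\<Sum>\<^sub>\<infinity>d\<in>?D. real (corr B d) * real (corr A d) ^ m)"
    unfolding higher_energy_def by (rule infsum_cong_neutral) (auto simp: zero)
  also have "\<dots> = (\<Sum>d\<in>?D. real (corr B d) * real (corr A d) ^ m)"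
    using D by simp
  also have "\<dots> = (\<Sum>d\<in>?D. \<Sum>p\<in>B \<times> B. of_bool (snd p - fst p = d) * real (corr A d) ^ m)"
    using assms by (simp add: corr_eq_sum sum_distrib_right case_prod_beta)
  also have "\<dots> = (\<Sum>p\<in>B \<times> B. \<Sum>d\<in>?D. of_bool (snd p - fst p = d) * real (corr A d) ^ m)"
    by (rule sum.swap)
  also have "\<dots> = (\<Sum>p\<in>B \<times> B. \<Sum>d\<in>?D. if snd p - fst p = d then real (corr A d) ^ m else 0)"
    by (intro sum.cong) auto
  also have "\<dots> = (\<Sum>p\<in>B \<times> B. real (corr A (snd p - fst p)) ^ m)"
    using D by (intro sum.cong refl) (auto simp: sum.delta)
  finally show ?thesis
    by (simp add: sum.cartesian_product')
qed

text \<open>Both memberships say that \<open>x i + s \<in> A\<close> for all \<open>i < k\<close>, a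
  condition symmetric in \<open>x i\<close> and \<open>s\<close>. The assumption supplies
  extensionality, which \<open>translate_power\<close> demands and \<open>translate_inter\<close>
  does not see.\<close>

lemma translate_inter_eq:
  assumes "x \<in> cart_power k UNIV"
  shows "translate_inter k A B x = {s \<in> B. x \<in> translate_power k A s}"
proof -
  have "t \<in> (\<lambda>a. a - u) ` A \<longleftrightarrow> u + t \<in> A" for t u
  proof
    assume "u + t \<in> A"
    then show "t \<in> (\<lambda>a. a - u) ` A"
      by (intro image_eqI[of _ _ "u + t"]) auto
  qed auto
  then have "s \<in> (\<lambda>a. a - x i) ` A \<longleftrightarrow> x i \<in> (\<lambda>a. a - s) ` A" for s i
    by (metis add.commute)
  then show ?thesis
    using assms by (auto simp: translate_inter_def translate_power_def cart_power_def PiE_iff)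
qed

text \<open>Subtracting a single constant tuple \<open>s\<close> from the power of \<open>A\<close>
  gives the power of \<open>A - s\<close>. With \<open>S\<close> the set
  \<open>translate_inter k A B x\<close>, this is the fibre over \<open>x\<close>.\<close>

lemma diffset_diagonal:
  "diffset l (cart_power l A) (diagonal l S) = (\<Union>s\<in>S. translate_power l A s)"
proof (intro equalityI subsetI)
  fix z assume "z \<in> (\<Union>s\<in>S. translate_power l A s)"
  then obtain s where s: "s \<in> S" "z \<in> translate_power l A s"
    by blast
  let ?a = "\<lambda>i\<in>{..<l}. z i + s"
  have "?a \<in> cart_power l A"
    using s(2) by (force simp: translate_power_def cart_power_def PiE_iff)
  moreover have "z = tuple_minus l ?a (\<lambda>i\<in>{..<l}. s)"
    using s(2) by (force simp: tuple_minus_def translate_power_def cart_power_def PiE_iff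
      extensional_def)
  ultimately show "z \<in> diffset l (cart_power l A) (diagonal l S)"
    using s(1) unfolding diffset_def diagonal_def by blast
qed (fastforce simp: diffset_def diagonal_def tuple_minus_def translate_power_def cart_power_def
  PiE_iff)

text \<open>Adding the diagonal of \<open>S\<close> is subtracting the diagonal of
  \<open>- S\<close>.\<close>

lemma sumset_diagonal:
  "sumset l (cart_power l A) (diagonal l S) = (\<Union>s\<in>S. translate_power l A (- s))"
proof -
  have "tuple_plus l a (\<lambda>i\<in>{..<l}. s) = tuple_minus l a (\<lambda>i\<in>{..<l}. - s)" for a s
    by (auto simp: tuple_plus_def tuple_minus_def)
  then have "sumset l X (diagonal l S) = diffset l X (diagonal l (uminus ` S))" for X
    unfolding sumset_def diffset_def diagonal_def by auto metis+
  then show ?thesis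
    by (simp add: diffset_diagonal)
qed

text \<open>A tuple with nonempty \<open>translate_inter\<close> lies in one of finitely many finite
  sets. This turns both sums of the theorem into finite ones, since their terms vanish when
  \<open>translate_inter\<close> is empty.\<close>

lemma infsum_cart_power_eq_sum:
  fixes f :: "(nat \<Rightarrow> 'a::ab_group_add) \<Rightarrow> 'c::{comm_monoid_add, t2_space}"
  assumes "finite A" and "finite B"
    and "\<And>x. x \<in> cart_power k UNIV \<Longrightarrow> translate_inter k A B x = {} \<Longrightarrow> f x = 0"
  shows "infsum f (cart_power k UNIV) = sum f (\<Union>s\<in>B. translate_power k A s)"
proof -
  have "infsum f (cart_power k UNIV) = infsum f (\<Union>s\<in>B. translate_power k A s)"
  proof (rule infsum_cong_neutral)
    fix x assume "x \<in> cart_power k UNIV - (\<Union>s\<in>B. translate_power k A s)"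
    then show "f x = 0"
      by (auto simp: translate_inter_eq intro!: assms(3))
  qed (auto simp: translate_power_def cart_power_def)
  then show ?thesis
    using assms(1,2) by (simp add: finite_translate_power)
qed

text \<open>The map \<open>\<phi>\<close> carries the sign: the identity gives the difference set,
  negation the sumset. Its hypothesis ensures that the intersections of the second factors have the
  same sizes for both.\<close>

lemma translate_union_inequality:
  fixes q :: "(nat \<Rightarrow> 'a::ab_group_add) \<Rightarrow> complex" and \<phi> :: "'a \<Rightarrow> 'a"
  assumes A: "finite A" and B: "finite B"
    and \<phi>: "\<And>s s'. corr A (\<phi> s' - \<phi> s) = corr A (s' - s)"
  shows "real (card A) ^ (2 * l) *
           (cmod (\<Sum>\<^sub>\<infinity>x\<in>cart_power k UNIV. q x * of_nat (card (translate_inter k A B x))))\<^sup>2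
         \<le> higher_energy (k + l + 1) B A *
           (\<Sum>\<^sub>\<infinity>x\<in>cart_power k UNIV.
              real (card (\<Union>s\<in>translate_inter k A B x. translate_power l A (\<phi> s))) * (cmod (q x))\<^sup>2)"
proof -
  let ?P = "translate_power k A" and ?Q = "\<lambda>s. translate_power l A (\<phi> s)"
  let ?X = "\<Union>s\<in>B. ?P s"
  have X: "translate_inter k A B x = {s \<in> B. x \<in> ?P s}" if "x \<in> ?X" for x
    using that by (intro translate_inter_eq) (auto simp: translate_power_def cart_power_def)
  have "(\<Sum>\<^sub>\<infinity>x\<in>cart_power k UNIV. q x * of_nat (card (translate_inter k A B x)))
      = (\<Sum>x\<in>?X. q x * of_nat (card {s \<in> B. x \<in> ?P s}))"
    using A B by (subst infsum_cart_power_eq_sum[where A = A and B = B])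
      (auto simp: X intro!: sum.cong)
  moreover have "(\<Sum>\<^sub>\<infinity>x\<in>cart_power k UNIV.
        real (card (\<Union>s\<in>translate_inter k A B x. ?Q s)) * (cmod (q x))\<^sup>2)
      = (\<Sum>x\<in>?X. real (card (\<Union>s\<in>{s \<in> B. x \<in> ?P s}. ?Q s)) * (cmod (q x))\<^sup>2)"
    using A B by (subst infsum_cart_power_eq_sum[where A = A and B = B])
      (auto simp: X intro!: sum.cong)
  \<comment> \<open>The two intersections contribute the powers \<open>k\<close> and
    \<open>l\<close> of the same \<open>corr A (s' - s)\<close>, hence the exponent
    \<open>k + l\<close> and the energy of order \<open>k + l + 1\<close>.\<close>
  moreover have "higher_energy (k + l + 1) B A
      = (\<Sum>s\<in>B. \<Sum>s'\<in>B. real (card (?P s \<inter> ?P s') * card (?Q s \<inter> ?Q s')))"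
    by (simp only: higher_energy_eq_sum[OF B])
      (simp add: card_translate_power_Int \<phi> power_add)
  moreover have "real (card A) ^ (2 * l) = (real (card A ^ l))\<^sup>2"
    by (simp add: power_mult[symmetric] mult.commute)
  ultimately show ?thesis
    using incidence_inequality[OF B, of ?P ?Q "card A ^ l" q]
    by (simp add: finite_translate_power[OF A] card_translate_power)
qed

theorem proposition16:
  fixes A B :: "'a::ab_group_add set"
    and k l :: nat
    and q :: "(nat \<Rightarrow> 'a) \<Rightarrow> complex"
  assumes "finite A" and "finite B" and "k > 0" and "l > 0"
  shows "real (card A) ^ (2 * l) *
           (cmod (\<Sum>\<^sub>\<infinity>x\<in>cart_power k UNIV. q x * of_nat (card (translate_inter k A B x))))\<^sup>2
         \<le> higher_energy (k + l + 1) B A *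
           (\<Sum>\<^sub>\<infinity>x\<in>cart_power k UNIV.
              real (card (sumset l (cart_power l A) (diagonal l (translate_inter k A B x))))
              * (cmod (q x))\<^sup>2)
       \<and> real (card A) ^ (2 * l) *
           (cmod (\<Sum>\<^sub>\<infinity>x\<in>cart_power k UNIV. q x * of_nat (card (translate_inter k A B x))))\<^sup>2
         \<le> higher_energy (k + l + 1) B A *
           (\<Sum>\<^sub>\<infinity>x\<in>cart_power k UNIV.
              real (card (diffset l (cart_power l A) (diagonal l (translate_inter k A B x))))
              * (cmod (q x))\<^sup>2)"
proof -
  \<comment> \<open>Negating both points reverses their difference, and \<open>corr A\<close> is
    even.\<close>
  have minus: "corr A (- s' - - s) = corr A (s' - s)" for s s'
    using corr_minus[of A "s' - s"] by (simp add: algebra_simps)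
  show ?thesis
    unfolding sumset_diagonal diffset_diagonal
    using translate_union_inequality[OF assms(1,2), where \<phi> = uminus, OF minus]
      translate_union_inequality[OF assms(1,2), where \<phi> = "\<lambda>s. s", OF refl]
    by blast
qed

end
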